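(* Let $\Omega\subseteq\mathbb{H}$ be a speared domain, let $f:\Omega\to\mathbb{H}$ be a slice regular function and let $J_0\in\mathbb{S}$. There exists a speared open subset $\Lambda\subseteq\Omega$, including both $\mathrm{core}(\Omega)$ and $\Omega_{J_0}^{\geqslant}$, such that the formula \[f(\alpha+\beta I)=(J-K)^{-1}\left[Jf(\alpha+\beta J)-Kf(\alpha+\beta K)\right]+I(J-K)^{-1}\left[f(\alpha+\beta J)-f(\alpha+\beta K)\right]\] holds for all $I,J,K\in\mathbb{S}$ and all $\alpha,\beta\in\mathbb{R}$ with $J\neq K$, $\beta\geq0$ and $\alpha+\beta I,\alpha+\beta J,\alpha+\beta K\in\Lambda$.
   Context: $\mathbb{H}$ is the algebra of quaternions (Euclidean topology), $\mathbb{S}=\{w\in\mathbb{H}: w^2=-1\}$. For $I\in\mathbb{S}$: $\mathbb{C}_I=\mathbb{R}+\mathbb{R}I$, $\mathbb{C}_I^{\geqslant}=\{\alpha+\beta I:\alpha,\beta\in\mathbb{R},\beta\ge0\}$. For $T\subseteq\mathbb{H}$: $T_I=T\cap\mathbb{C}_I$, $T_I^{\geqslant}=T\cap\mathbb{C}_I^{\geqslant}$. A domain is a nonempty connected open subset of $\mathbb{H}$. A function $f:\Omega\to\mathbb{H}$ on a domain is slice regular if for every $I\in\mathbb{S}$ the restriction $f_{|\Omega_I}$ is $C^1$ and $\left(\frac{\partial}{\partial\alpha}+I\frac{\partial}{\partial\beta}\right)f(\alpha+\beta I)=0$ on $\Omega_I$. An open $U\subseteq\mathbb{H}$ is speared if,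 for all $I\in\mathbb{S}$, each connected component of $U_I^{\geqslant}$ includes a real point. A speared domain is a domain that is a speared open set. A set $T\subseteq\mathbb{H}$ is symmetric if $\alpha+\beta I\in T$ ($\alpha,\beta\in\mathbb{R}$, $I\in\mathbb{S}$) implies $\alpha+\beta\mathbb{S}\subseteq T$. For $U$ open, $\mathrm{core}(U)$ is the largest symmetric speared open subset of $U$. *)

theory Defs
  imports "HOL-Analysis.Analysis"
begin

section \<open>The quaternions as a real normed division algebra\<close>

codatatype quat = Quat (Re: real) (Im1: real) (Im2: real) (Im3: real)

hide_const (open) Re

abbreviation qre :: "quat \<Rightarrow> real" where "qre \<equiv> quat.Re"

lemma quat_eqI [intro?]:
  "\<lbrakk>qre x = qre y; Im1 x = Im1 y; Im2 x = Im2 y; Im3 x = Im3 y\<rbrakk> \<Longrightarrow> x = y"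
  by (rule quat.expand) simp

lemma quat_eq_iff:
  "x = y \<longleftrightarrow> qre x = qre y \<and> Im1 x = Im1 y \<and> Im2 x = Im2 y \<and> Im3 x = Im3 y"
  by (auto intro: quat.expand)

instantiation quat :: ab_group_add
begin

primcorec zero_quat where
  "qre 0 = 0" | "Im1 0 = 0" | "Im2 0 = 0" | "Im3 0 = 0"

primcorec plus_quat where
  "qre (x + y) = qre x + qre y"
| "Im1 (x + y) = Im1 x + Im1 y"
| "Im2 (x + y) = Im2 x + Im2 y"
| "Im3 (x + y) = Im3 x + Im3 y"

primcorec uminus_quat where
  "qre (- x) = - qre x"
| "Im1 (- x) = - Im1 x"
| "Im2 (- x) = - Im2 x"
| "Im3 (- x) = - Im3 x"

primcorec minus_quat where
  "qre (x - y) = qre x - qre y"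
| "Im1 (x - y) = Im1 x - Im1 y"
| "Im2 (x - y) = Im2 x - Im2 y"
| "Im3 (x - y) = Im3 x - Im3 y"

instance
  by standard (simp_all add: quat_eq_iff)

end

instantiation quat :: real_vector
begin

primcorec scaleR_quat where
  "qre (scaleR r x) = r * qre x"
| "Im1 (scaleR r x) = r * Im1 x"
| "Im2 (scaleR r x) = r * Im2 x"
| "Im3 (scaleR r x) = r * Im3 x"

instance
  by standard (simp_all add: quat_eq_iff algebra_simps)

end

instantiation quat :: real_algebra_1
begin

primcorec one_quat where
  "qre 1 = 1" | "Im1 1 = 0" | "Im2 1 = 0" | "Im3 1 = 0"

primcorec times_quat where
  "qre (x * y) = qre x * qre y - Im1 x * Im1 y - Im2 x * Im2 y - Im3 x * Im3 y"
| "Im1 (x * y) = qre x * Im1 y + Im1 x * qre y + Im2 x * Im3 y - Im3 x * Im2 y"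
| "Im2 (x * y) = qre x * Im2 y - Im1 x * Im3 y + Im2 x * qre y + Im3 x * Im1 y"
| "Im3 (x * y) = qre x * Im3 y + Im1 x * Im2 y - Im2 x * Im1 y + Im3 x * qre y"

instance
  by standard (simp_all add: quat_eq_iff algebra_simps)

end

lemma of_real_quat [simp]:
  "qre (of_real r) = r" "Im1 (of_real r) = 0" "Im2 (of_real r) = 0" "Im3 (of_real r) = 0"
  by (simp_all add: of_real_def)

instantiation quat :: real_inner
begin

definition inner_quat_def:
  "inner x y = qre x * qre y + Im1 x * Im1 y + Im2 x * Im2 y + Im3 x * Im3 y"

definition norm_quat_def:
  "norm x = sqrt ((qre x)\<^sup>2 + (Im1 x)\<^sup>2 + (Im2 x)\<^sup>2 + (Im3 x)\<^sup>2)"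

definition sgn_quat_def: "sgn (x :: quat) = x /\<^sub>R norm x"

definition dist_quat_def: "dist (x :: quat) y = norm (x - y)"

definition uniformity_quat_def [code del]:
  "(uniformity :: (quat \<times> quat) filter) = (INF e\<in>{0 <..}. principal {(x, y). dist x y < e})"

definition open_quat_def [code del]:
  "open (U :: quat set) \<longleftrightarrow>
    (\<forall>x\<in>U. eventually (\<lambda>(x', y). x' = x \<longrightarrow> y \<in> U) uniformity)"

instance
proof
  fix x y z :: quat and r :: real and U :: "quat set"
  show "dist x y = norm (x - y)" by (rule dist_quat_def)
  show "sgn x = x /\<^sub>R norm x" by (rule sgn_quat_def)
  show "(uniformity :: (quat \<times> quat) filter) = (INF e\<in>{0 <..}. principal {(x, y). dist x y < e})"
    by (rule uniformity_quat_def)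
  show "open U \<longleftrightarrow> (\<forall>x\<in>U. eventually (\<lambda>(x', y). x' = x \<longrightarrow> y \<in> U) uniformity)"
    by (rule open_quat_def)
  show "inner x y = inner y x"
    unfolding inner_quat_def by (simp add: mult.commute)
  show "inner (x + y) z = inner x z + inner y z"
    unfolding inner_quat_def by (simp add: algebra_simps)
  show "inner (scaleR r x) y = r * inner x y"
    unfolding inner_quat_def by (simp add: algebra_simps)
  show "0 \<le> inner x x"
    unfolding inner_quat_def by simp
  show "inner x x = 0 \<longleftrightarrow> x = 0"
    unfolding inner_quat_def by (auto simp: add_nonneg_eq_0_iff quat_eq_iff)
  show "norm x = sqrt (inner x x)"
    unfolding inner_quat_def norm_quat_def by (simp add: power2_eq_square)
qed

end

lemma norm_quat_sq: "(norm x)\<^sup>2 = (qre x)\<^sup>2 + (Im1 x)\<^sup>2 + (Im2 x)\<^sup>2 + (Im3 x)\<^sup>2"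
  unfolding norm_quat_def by simp

instantiation quat :: real_normed_div_algebra
begin

text \<open>The inverse of \<open>x\<close> is its conjugate divided by \<open>(norm x)\<^sup>2\<close>.\<close>

primcorec inverse_quat where
  "qre (inverse x) = qre x / (norm x)\<^sup>2"
| "Im1 (inverse x) = - Im1 x / (norm x)\<^sup>2"
| "Im2 (inverse x) = - Im2 x / (norm x)\<^sup>2"
| "Im3 (inverse x) = - Im3 x / (norm x)\<^sup>2"

definition divide_quat_def: "x div (y :: quat) = x * inverse y"

instance
proof
  fix x y :: quat
  show "x div y = x * inverse y" by (rule divide_quat_def)
  show "inverse (0 :: quat) = 0"
    by (simp add: quat_eq_iff)
  have e: "(qre x * qre x + Im1 x * Im1 x + Im2 x * Im2 x + Im3 x * Im3 x) / (norm x)\<^sup>2 = 1"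
    if "x \<noteq> 0"
  proof -
    have "(norm x)\<^sup>2 \<noteq> 0" using that by simp
    then show ?thesis
      by (metis norm_quat_sq power2_eq_square divide_self)
  qed
  show "inverse x * x = 1" if "x \<noteq> 0"
    using e[OF that] by (simp add: quat_eq_iff add_divide_distrib mult.commute)
  show "x * inverse x = 1" if "x \<noteq> 0"
    using e[OF that] by (simp add: quat_eq_iff add_divide_distrib mult.commute)
  have "(norm (x * y))\<^sup>2 = (norm x * norm y)\<^sup>2"
    unfolding norm_quat_sq power_mult_distrib times_quat.simps by algebra
  then show "norm (x * y) = norm x * norm y"
    by (simp add: power2_eq_iff_nonneg)
qed

end

instantiation quat :: euclidean_space
begin

definition Basis_quat_def:
  "Basis = {Quat 1 0 0 0, Quat 0 1 0 0, Quat 0 0 1 0, Quat 0 0 0 1}"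

instance
proof
  show "(Basis :: quat set) \<noteq> {}" and "finite (Basis :: quat set)"
    by (simp_all add: Basis_quat_def)
  show "inner u v = (if u = v then 1 else 0)" if "u \<in> Basis" "v \<in> Basis" for u v :: quat
    using that unfolding Basis_quat_def by (elim insertE emptyE) (simp_all add: inner_quat_def)
  show "(\<forall>u\<in>Basis. inner x u = 0) \<longleftrightarrow> x = 0" for x :: quat
    by (simp add: Basis_quat_def inner_quat_def quat_eq_iff[of x])
qed

end


section \<open>Slices, symmetric sets and speared sets\<close>

definition imag_units :: "quat set" ("\<S>") where
  "\<S> = {w. w * w = - 1}"

abbreviation slice_pt :: "real \<Rightarrow> real \<Rightarrow> quat \<Rightarrow> quat" where
  "slice_pt \<alpha> \<beta> I \<equiv> of_real \<alpha> + of_real \<beta> * I"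

definition half_slice :: "quat \<Rightarrow> quat set" where
  "half_slice I = {slice_pt \<alpha> \<beta> I | \<alpha> \<beta>. 0 \<le> \<beta>}"

text \<open>\<open>\<real> :: quat set\<close> is the library's range of \<^const>\<open>of_real\<close>.\<close>

definition speared_open :: "quat set \<Rightarrow> bool" where
  "speared_open U \<longleftrightarrow>
     open U \<and> (\<forall>I\<in>\<S>. \<forall>C\<in>components (U \<inter> half_slice I). C \<inter> \<real> \<noteq> {})"

definition is_domain :: "quat set \<Rightarrow> bool" where
  "is_domain U \<longleftrightarrow> U \<noteq> {} \<and> connected U \<and> open U"

definition speared_domain :: "quat set \<Rightarrow> bool" where
  "speared_domain U \<longleftrightarrow> is_domain U \<and> speared_open U"

definition symmetric_set :: "quat set \<Rightarrow> bool" where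
  "symmetric_set T \<longleftrightarrow>
     (\<forall>\<alpha> \<beta>. \<forall>I\<in>\<S>. slice_pt \<alpha> \<beta> I \<in> T \<longrightarrow> (\<forall>J\<in>\<S>. slice_pt \<alpha> \<beta> J \<in> T))"

definition core :: "quat set \<Rightarrow> quat set" where
  "core U = (GREATEST V. V \<subseteq> U \<and> symmetric_set V \<and> speared_open V)"

text \<open>The greatest set in the definition of \<^const>\<open>core\<close> exists, namely as a union.\<close>

lemma speared_open_Union:
  assumes "\<And>V. V \<in> \<V> \<Longrightarrow> speared_open V"
  shows "speared_open (\<Union>\<V>)"
  unfolding speared_open_def
proof (intro conjI ballI)
  show "open (\<Union>\<V>)"
    using assms by (auto simp: speared_open_def)
next
  fix I C assume I: "I \<in> \<S>" and C: "C \<in> components (\<Union>\<V> \<inter> half_slice I)"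
  from C obtain x where x: "x \<in> \<Union>\<V> \<inter> half_slice I"
    and Cx: "C = connected_component_set (\<Union>\<V> \<inter> half_slice I) x"
    by (auto simp: components_iff)
  from x obtain V where V: "V \<in> \<V>" and xV: "x \<in> V \<inter> half_slice I" by blast
  let ?D = "connected_component_set (V \<inter> half_slice I) x"
  have "?D \<in> components (V \<inter> half_slice I)"
    using xV by (auto simp: components_iff)
  then have "?D \<inter> \<real> \<noteq> {}"
    using assms[OF V] I by (auto simp: speared_open_def)
  moreover have "?D \<subseteq> C"
    unfolding Cx by (rule connected_component_mono) (use V in blast)
  ultimately show "C \<inter> \<real> \<noteq> {}" by blast
qed

lemma symmetric_set_Union:
  assumes "\<And>V. V \<in> \<V> \<Longrightarrow> symmetric_set V"
  shows "symmetric_set (\<Union>\<V>)"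
  using assms unfolding symmetric_set_def by (meson Union_iff)

lemma
  fixes U :: "quat set"
  defines "W \<equiv> \<Union>{V. V \<subseteq> U \<and> symmetric_set V \<and> speared_open V}"
  shows core_eq_Union: "core U = W"
    and core_subset: "core U \<subseteq> U"
    and symmetric_core: "symmetric_set (core U)"
    and speared_open_core: "speared_open (core U)"
proof -
  have W: "W \<subseteq> U" "symmetric_set W" "speared_open W"
    unfolding W_def by (blast, rule symmetric_set_Union, blast, rule speared_open_Union, blast)
  show eq: "core U = W"
    unfolding core_def
    by (rule Greatest_equality) (use W in \<open>auto simp: W_def\<close>)
  show "core U \<subseteq> U" "symmetric_set (core U)" "speared_open (core U)"
    unfolding eq by (rule W)+
qed

lemma core_greatest:
  "\<lbrakk>V \<subseteq> U; symmetric_set V; speared_open V\<rbrakk> \<Longrightarrow> V \<subseteq> core U"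
  unfolding core_eq_Union by blast


section \<open>Slice regular functions\<close>

definition C1_on ::
  "'a::real_normed_vector set \<Rightarrow> ('a \<Rightarrow> 'b::real_normed_vector) \<Rightarrow> bool" where
  "C1_on U g \<longleftrightarrow>
     (\<exists>g'. (\<forall>p\<in>U. (g has_derivative blinfun_apply (g' p)) (at p)) \<and> continuous_on U g')"

text \<open>
  A function on \<open>\<Omega>\<close> is a total function of which only the values on \<open>\<Omega>\<close> matter. The restriction
  to the slice of \<open>I\<close> is read in the real coordinates \<open>(\<alpha>, \<beta>)\<close>; since \<open>\<Omega>\<close> is open, so is its
  preimage in the coordinate plane, and the derivatives below only involve values on \<open>\<Omega>\<close>.
\<close>

definition slice_regular_on :: "quat set \<Rightarrow> (quat \<Rightarrow> quat) \<Rightarrow> bool" where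
  "slice_regular_on \<Omega> f \<longleftrightarrow> (\<forall>I\<in>\<S>.
     C1_on {(\<alpha>, \<beta>). slice_pt \<alpha> \<beta> I \<in> \<Omega>} (\<lambda>(\<alpha>, \<beta>). f (slice_pt \<alpha> \<beta> I)) \<and>
     (\<forall>\<alpha> \<beta>. slice_pt \<alpha> \<beta> I \<in> \<Omega> \<longrightarrow>
        vector_derivative (\<lambda>t. f (slice_pt t \<beta> I)) (at \<alpha>)
        + I * vector_derivative (\<lambda>t. f (slice_pt \<alpha> t I)) (at \<beta>) = 0))"

end

theory Submission
  imports Defs "HOL-Complex_Analysis.Complex_Analysis"
begin

text \<open>
  If a connected set \<open>C\<close> of the closed upper half plane meets the real axis and its copies in the
  slices of \<open>I\<close>, \<open>J\<close>, \<open>K\<close> all lie in \<open>\<Omega>\<close>, then the difference of the two sides of the formula is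
  killed by \<open>\<partial>/\<partial>\<alpha> + I \<partial>/\<partial>\<beta>\<close> near \<open>C\<close> and vanishes at real points, so it vanishes on \<open>C\<close> by the
  identity principle. It remains to choose \<open>\<Lambda>\<close> such that three points \<open>\<alpha> + \<beta>I\<close>, \<open>\<alpha> + \<beta>J\<close>, \<open>\<alpha> + \<beta>K\<close>
  of \<open>\<Lambda>\<close> always share such a \<open>C\<close>. Add to the core those points \<open>\<alpha> + \<beta>I\<close> for which some \<open>C\<close> through
  \<open>\<alpha> + \<beta>\<i>\<close> has its copies in \<open>\<Omega>\<close> for all units in a ball around \<open>J\<^sub>0\<close> containing \<open>I\<close>: these balls
  are concentric, so among three points the \<open>C\<close> of the largest ball serves all of them. In the core
  a common \<open>C\<close> exists by symmetry. Real points of \<open>\<Omega>\<close> lie in the core, which makes \<open>\<Lambda>\<close> open there.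
\<close>

section \<open>Slices as isometric copies of the complex plane\<close>

definition slice_emb :: "quat \<Rightarrow> complex \<Rightarrow> quat" where
  "slice_emb I z = slice_pt (Re z) (Im z) I"

text \<open>For a unit \<open>I\<close> this is the orthogonal projection onto its slice, read in
  complex coordinates. Being defined on all quaternions, it gives a continuous left inverse of
  \<open>slice_emb I\<close>.\<close>

definition slice_coord :: "quat \<Rightarrow> quat \<Rightarrow> complex" where
  "slice_coord I q = Complex (qre q) (inner q I)"

lemma imag_units_sq: "I \<in> \<S> \<Longrightarrow> I * I = -1"
  by (simp add: imag_units_def)

lemma norm_imag_unit:
  assumes "I \<in> \<S>"
  shows "norm I = 1"
proof -
  have "norm I * norm I = 1"
    by (metis assms imag_units_sq norm_minus_cancel norm_mult norm_one)
  then show ?thesis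
    by (metis abs_norm_cancel abs_square_eq_1 power2_eq_square)
qed

text \<open>The real part of \<open>I * I = -1\<close> and the squared norm of \<open>I\<close> give
  two equations whose sum is \<open>2 * (qre I)^2 = 0\<close>.\<close>

lemma qre_imag_unit:
  assumes "I \<in> \<S>"
  shows "qre I = 0"
proof -
  have "qre (I * I) = -1"
    using imag_units_sq[OF assms] by simp
  then have "(qre I)\<^sup>2 - (Im1 I)\<^sup>2 - (Im2 I)\<^sup>2 - (Im3 I)\<^sup>2 = -1"
    by (simp add: power2_eq_square)
  moreover have "(qre I)\<^sup>2 + (Im1 I)\<^sup>2 + (Im2 I)\<^sup>2 + (Im3 I)\<^sup>2 = 1"
    using norm_quat_sq[of I] norm_imag_unit[OF assms] by simp
  ultimately have "(qre I)\<^sup>2 = 0" by linarith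
  then show ?thesis by simp
qed

lemma imag_unitI:
  assumes "qre I = 0" "norm I = 1"
  shows "I \<in> \<S>"
proof -
  have "(Im1 I)\<^sup>2 + (Im2 I)\<^sup>2 + (Im3 I)\<^sup>2 = 1"
    using norm_quat_sq[of I] assms by simp
  then show ?thesis
    using assms(1) by (simp add: imag_units_def quat_eq_iff power2_eq_square)
qed

lemma compact_imag_units: "compact \<S>"
proof -
  have "\<S> = sphere 0 1 \<inter> {q. q * q = -1}"
    using norm_imag_unit by (auto simp: imag_units_def)
  moreover have "closed {q::quat. q * q = -1}"
    by (intro closed_Collect_eq continuous_intros)
  ultimately show ?thesis
    by (metis compact_Int_closed compact_sphere)
qed

lemma slice_emb_linear: "linear (slice_emb I)"
  by (rule linearI) (simp_all add: slice_emb_def algebra_simps scaleR_conv_of_real)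

lemma slice_emb_diff: "slice_emb I z - slice_emb I w = slice_emb I (z - w)"
  by (simp add: slice_emb_def algebra_simps)

lemma slice_emb_of_real [simp]: "slice_emb I (of_real r) = of_real r"
  by (simp add: slice_emb_def)

lemma slice_emb_real: "Im z = 0 \<Longrightarrow> slice_emb I z = of_real (Re z)"
  by (simp add: slice_emb_def)

lemma continuous_on_slice_emb [continuous_intros]:
  "continuous_on S g \<Longrightarrow> continuous_on S (\<lambda>x. slice_emb I (g x))"
  unfolding slice_emb_def by (intro continuous_intros)

lemma qre_slice_emb: "I \<in> \<S> \<Longrightarrow> qre (slice_emb I z) = Re z"
  by (simp add: slice_emb_def qre_imag_unit)

lemma norm_slice_emb:
  assumes "I \<in> \<S>"
  shows "norm (slice_emb I z) = norm z"
proof -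
  have s: "(Im1 I)\<^sup>2 + (Im2 I)\<^sup>2 + (Im3 I)\<^sup>2 = 1"
    using norm_quat_sq[of I] norm_imag_unit[OF assms] qre_imag_unit[OF assms] by simp
  have "(norm (slice_emb I z))\<^sup>2 
      = (Re z)\<^sup>2 + (Im z)\<^sup>2 * ((Im1 I)\<^sup>2 + (Im2 I)\<^sup>2 + (Im3 I)\<^sup>2)"
    by (simp add: norm_quat_sq slice_emb_def qre_imag_unit[OF assms] algebra_simps power_mult_distrib)
  then have "(norm (slice_emb I z))\<^sup>2 = (norm z)\<^sup>2"
    unfolding s by (simp add: cmod_power2)
  then show ?thesis by simp
qed

lemma dist_slice_emb: "I \<in> \<S> \<Longrightarrow> dist (slice_emb I z) (slice_emb I w) = dist z w"
  by (simp add: dist_norm slice_emb_diff norm_slice_emb)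

lemma slice_coord_emb:
  assumes "I \<in> \<S>"
  shows "slice_coord I (slice_emb I z) = z"
proof -
  have "inner 1 I = 0"
    using qre_imag_unit[OF assms] by (simp add: inner_quat_def)
  moreover have "inner I I = 1"
    using norm_imag_unit[OF assms] by (simp add: dot_square_norm)
  ultimately have "inner (Re z *\<^sub>R 1 + Im z *\<^sub>R I) I = Im z"
    by (simp add: inner_add_left)
  then have "inner (slice_emb I z) I = Im z"
    by (simp add: slice_emb_def scaleR_conv_of_real)
  then show ?thesis
    by (simp add: slice_coord_def qre_slice_emb[OF assms])
qed

lemma continuous_on_qre [continuous_intros]:
  assumes "continuous_on S g"
  shows "continuous_on S (\<lambda>x. qre (g x))"
proof -
  have "qre q = inner q 1" for q by (simp add: inner_quat_def)
  then show ?thesis using assms by (simp add: continuous_on_inner)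
qed

lemma continuous_on_slice_coord: "continuous_on S (slice_coord I)"
proof -
  have "slice_coord I = (\<lambda>q. of_real (qre q) + \<i> * of_real (inner q I))"
    by (simp add: slice_coord_def fun_eq_iff complex_eq_iff)
  then show ?thesis by (auto intro!: continuous_intros)
qed

text \<open>Equal real parts leave \<open>Im z\<close> times \<open>I\<close> equal to
  \<open>Im w\<close> times \<open>J\<close>, and taking norms forces equal coefficients because of
  the signs. Strict positivity excludes the real points, which lie in every slice.\<close>

lemma slice_emb_eqD:
  assumes "slice_emb I z = slice_emb J w" "I \<in> \<S>" "J \<in> \<S>" "Im z > 0" "Im w \<ge> 0"
  shows "I = J" "z = w"
proof -
  have re: "Re z = Re w"
    using assms qre_slice_emb by metis
  then have *: "Im z *\<^sub>R I = Im w *\<^sub>R J"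
    using assms(1) by (simp add: slice_emb_def scaleR_conv_of_real)
  then have "norm (Im z *\<^sub>R I) = norm (Im w *\<^sub>R J)" by simp
  then have im: "Im z = Im w"
    using assms by (simp add: norm_imag_unit)
  then show "I = J" using * assms(4) by simp
  show "z = w" using re im by (simp add: complex_eq_iff)
qed

lemma half_slice_eq: "half_slice I = slice_emb I ` {z. 0 \<le> Im z}"
proof
  show "half_slice I \<subseteq> slice_emb I ` {z. 0 \<le> Im z}"
  proof
    fix x assume "x \<in> half_slice I"
    then obtain a b where "x = slice_emb I (Complex a b)" "0 \<le> b"
      by (auto simp: half_slice_def slice_emb_def)
    then show "x \<in> slice_emb I ` {z. 0 \<le> Im z}" by auto
  qed
qed (auto simp: half_slice_def slice_emb_def)

lemma convex_half_slice: "convex (half_slice I)"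
  unfolding half_slice_eq
  by (intro convex_linear_image slice_emb_linear convex_halfspace_Im_ge)

subsection \<open>Speared sets\<close>

text \<open>\<open>C\<close> lives in the complex plane and not in a slice, so that one set can be
  copied into several slices at once.\<close>

definition spear :: "complex \<Rightarrow> complex set \<Rightarrow> bool" where
  "spear z C \<longleftrightarrow> connected C \<and> C \<subseteq> {w. 0 \<le> Im w} \<and> z \<in> C \<and> C \<inter> \<real> \<noteq> {}"

text \<open>A component absorbs every connected subset that meets it, here the copy of
  \<open>C\<close>; this copy contains a real point because \<open>slice_emb\<close> fixes the
  reals.\<close>

lemma speared_openI:
  assumes "open U"
    and "\<And>I z. I \<in> \<S> \<Longrightarrow> 0 \<le> Im z \<Longrightarrow> slice_emb I z \<in> U \<Longrightarrow> \<exists>C. spear z C \<and> slice_emb I ` C \<subseteq> U"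
  shows "speared_open U"
  unfolding speared_open_def
proof (intro conjI ballI)
  fix I D assume I: "I \<in> \<S>" and D: "D \<in> components (U \<inter> half_slice I)"
  then obtain z where z: "0 \<le> Im z" "slice_emb I z \<in> U" "slice_emb I z \<in> D"
    using in_components_nonempty[OF D] in_components_subset[OF D]
    unfolding half_slice_eq by fast
  then obtain C where C: "spear z C" "slice_emb I ` C \<subseteq> U"
    using assms(2) I by blast
  have "slice_emb I ` C \<subseteq> D"
  proof (rule components_maximal[OF D])
    show "connected (slice_emb I ` C)"
      using C by (auto simp: spear_def intro!: connected_continuous_image continuous_intros)
  qed (use C z in \<open>auto simp: spear_def half_slice_eq\<close>)
  moreover obtain r where "of_real r \<in> C"
    using C by (auto simp: spear_def Reals_def)
  ultimately have "of_real r \<in> D"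
    using slice_emb_of_real by (metis image_subset_iff)
  then show "D \<inter> \<real> \<noteq> {}" by auto
qed (rule assms)

text \<open>The half slice is convex, so its relatively open subsets are locally path connected and
  a path joins the point to a real point. The path image supplies compactness, which later yields
  balls of one radius around all points of the spear.\<close>

lemma speared_openE:
  assumes U: "speared_open U" and I: "I \<in> \<S>" and z: "0 \<le> Im z" "slice_emb I z \<in> U"
  obtains C where "spear z C" "compact C" "slice_emb I ` C \<subseteq> U"
proof -
  let ?H = "U \<inter> half_slice I" and ?x = "slice_emb I z"
  have x: "?x \<in> ?H" using z by (auto simp: half_slice_eq)
  have "locally path_connected ?H"
  proof (rule locally_open_subset)
    show "locally path_connected (half_slice I)"
      by (rule convex_imp_locally_path_connected[OF convex_half_slice])
    show "openin (top_of_set (half_slice I)) ?H"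
      using U by (auto simp: speared_open_def openin_open)
  qed
  then have eq: "path_component_set ?H ?x = connected_component_set ?H ?x"
    by (rule path_component_eq_connected_component_set)
  have "connected_component_set ?H ?x \<in> components ?H"
    using x by (auto simp: components_iff)
  then obtain r where "r \<in> path_component_set ?H ?x" "r \<in> \<real>"
    using U I unfolding speared_open_def eq by blast
  then obtain g where g: "path g" "path_image g \<subseteq> ?H" "pathstart g = ?x" "pathfinish g = r"
    by (auto simp: path_component_def)
  let ?C = "slice_coord I ` path_image g"
  have emb: "slice_emb I (slice_coord I y) = y \<and> 0 \<le> Im (slice_coord I y)" if "y \<in> path_image g" for y
    using that g(2) I by (auto simp: half_slice_eq slice_coord_emb)
  obtain t where t: "r = of_real t" using \<open>r \<in> \<real>\<close> by (auto simp: Reals_def)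
  have "slice_coord I r = of_real t"
    using slice_coord_emb[OF I, of "of_real t"] t by simp
  then have "of_real t \<in> ?C"
    using g(4) pathfinish_in_path_image by (metis imageI)
  moreover have "z \<in> ?C"
    using g(3) pathstart_in_path_image slice_coord_emb[OF I, of z] by (metis imageI)
  moreover have "connected ?C"
    by (intro connected_continuous_image continuous_on_slice_coord connected_path_image g)
  ultimately have "spear z ?C"
    using emb Reals_of_real[of t] unfolding spear_def by blast
  moreover have "compact ?C"
    by (intro compact_continuous_image continuous_on_slice_coord compact_path_image g)
  moreover have "slice_emb I ` ?C \<subseteq> U" using emb g(2) by auto
  ultimately show ?thesis by (rule that)
qed

text \<open>A ball centred at a real point is symmetric, since each \<open>slice_emb I\<close> is an
  isometry fixing the centre, and speared, since half discs are convex.\<close>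

lemma of_real_in_core:
  assumes "open U" "of_real r \<in> U"
  shows "of_real r \<in> core U"
proof -
  obtain e where e: "e > 0" "ball (of_real r) e \<subseteq> U"
    using assms openE by blast
  have mem: "slice_emb I z \<in> ball (of_real r) e \<longleftrightarrow> z \<in> ball (of_real r) e" if "I \<in> \<S>" for I z
    using dist_slice_emb[OF that, of "of_real r" z] by simp
  have "symmetric_set (ball (of_real r) e)"
    unfolding symmetric_set_def
    using mem[where z = "Complex _ _"] by (simp add: slice_emb_def)
  moreover have "speared_open (ball (of_real r) e)"
  proof (rule speared_openI)
    fix I z assume I: "I \<in> \<S>" and z: "0 \<le> Im z" "slice_emb I z \<in> ball (of_real r) e"
    have "convex (ball (of_real r) e \<inter> {w::complex. 0 \<le> Im w})"
      by (intro convex_Int convex_ball convex_halfspace_Im_ge)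
    moreover have "complex_of_real r \<in> ball (of_real r) e \<inter> {w. 0 \<le> Im w} \<inter> \<real>"
      using e(1) by simp
    ultimately have "spear z (ball (of_real r) e \<inter> {w. 0 \<le> Im w})"
      using z mem[OF I] convex_connected unfolding spear_def by blast
    moreover have "slice_emb I ` (ball (of_real r) e \<inter> {w. 0 \<le> Im w}) \<subseteq> ball (of_real r) e"
      using mem[OF I] by auto
    ultimately show "\<exists>C. spear z C \<and> slice_emb I ` C \<subseteq> ball (of_real r) e" by blast
  qed auto
  ultimately show ?thesis
    using core_greatest[OF e(2)] e(1) by auto
qed

subsection \<open>The representation formula along a common spear\<close>

text \<open>Left multiplication by \<open>I\<close> turns the regularity equation into
  \<open>D \<i> = I * D 1\<close>, which is complex linearity of the derivative when
  \<open>I\<close> acts from the left as imaginary unit.\<close>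

lemma slice_regular_has_derivative:
  assumes "slice_regular_on \<Omega> f" "I \<in> \<S>" "slice_emb I z \<in> \<Omega>"
  obtains D where "((\<lambda>w. f (slice_emb I w)) has_derivative D) (at z)" "D \<i> = I * D 1"
proof -
  let ?g = "\<lambda>(\<alpha>, \<beta>). f (slice_pt \<alpha> \<beta> I)"
  have pt: "slice_pt (Re z) (Im z) I \<in> \<Omega>"
    using assms(3) by (simp add: slice_emb_def)
  obtain g' where "(?g has_derivative blinfun_apply (g' (Re z, Im z))) (at (Re z, Im z))"
    using assms(1,2) pt unfolding slice_regular_on_def C1_on_def by blast
  then obtain G where G: "(?g has_derivative G) (at (Re z, Im z))" by blast
  have lin: "linear G" using G by (rule has_derivative_linear)
  \<comment> \<open>Used three times: for the passage from real pairs to \<open>complex\<close>, and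
    for the two coordinate lines through the point.\<close>
  have chain: "((\<lambda>t. ?g (p t)) has_derivative (\<lambda>v. G (p' v))) (at x)"
    if "(p has_derivative p') (at x)" "p x = (Re z, Im z)"
    for p :: "'a::real_normed_vector \<Rightarrow> real \<times> real" and p' x
    by (rule has_derivative_compose[OF that(1)]) (simp add: that(2) G)
  have "((\<lambda>w. ?g (Re w, Im w)) has_derivative (\<lambda>v. G (Re v, Im v))) (at z)"
    by (rule chain) (auto intro!: derivative_eq_intros)
  then have 1: "((\<lambda>w. f (slice_emb I w)) has_derivative (\<lambda>v. G (Re v, Im v))) (at z)"
    by (simp add: slice_emb_def)
  have G_scale: "v *\<^sub>R G (1, 0) = G (v, 0)" "v *\<^sub>R G (0, 1) = G (0, v)" for v
    using linear_cmul[OF lin, of v "(1, 0)"] linear_cmul[OF lin, of v "(0, 1)"] by simp_all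
  have "((\<lambda>t. ?g (t, Im z)) has_derivative (\<lambda>v. G (v, 0))) (at (Re z))"
    by (rule chain) (auto intro!: derivative_eq_intros)
  then have "((\<lambda>t. f (slice_pt t (Im z) I)) has_vector_derivative G (1, 0)) (at (Re z))"
    by (simp add: has_vector_derivative_def G_scale)
  moreover have "((\<lambda>t. ?g (Re z, t)) has_derivative (\<lambda>v. G (0, v))) (at (Im z))"
    by (rule chain) (auto intro!: derivative_eq_intros)
  then have "((\<lambda>t. f (slice_pt (Re z) t I)) has_vector_derivative G (0, 1)) (at (Im z))"
    by (simp add: has_vector_derivative_def G_scale)
  ultimately have "G (1, 0) + I * G (0, 1) = 0"
    using assms(1,2) pt unfolding slice_regular_on_def
    by (metis vector_derivative_at)
  then have "I * G (1, 0) + (I * I) * G (0, 1) = 0"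
    by (metis distrib_left mult.assoc mult_zero_right)
  then have "G (0, 1) = I * G (1, 0)"
    using assms(2) by (simp add: imag_units_sq)
  with 1 show ?thesis by (intro that) auto
qed

text \<open>
  For every \<open>v\<close>, the map \<open>q \<mapsto> \<langle>q, v\<rangle> - \<i> \<langle>I q, v\<rangle>\<close> turns left multiplication by \<open>I\<close> into
  multiplication by \<open>\<i>\<close>, so its composition with \<open>h\<close> is holomorphic.
\<close>

lemma slice_identity_principle:
  fixes h :: "complex \<Rightarrow> quat"
  assumes I: "I \<in> \<S>" and U: "open U"
    and h: "\<And>z. z \<in> U \<Longrightarrow> \<exists>D. (h has_derivative D) (at z) \<and> D \<i> = I * D 1"
    and h0: "\<And>r. of_real r \<in> U \<Longrightarrow> h (of_real r) = 0"
    and C: "connected C" "C \<subseteq> U" "C \<inter> \<real> \<noteq> {}" "z \<in> C"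
  shows "h z = 0"
proof -
  obtain r where r: "of_real r \<in> C" using C by (auto simp: Reals_def)
  \<comment> \<open>Analytic continuation requires an open connected set, so \<open>C\<close> is
    enlarged to the component of \<open>U\<close> containing it.\<close>
  let ?S = "connected_component_set U (of_real r)"
  have S: "open ?S" "connected ?S" "?S \<subseteq> U" "of_real r \<in> ?S"
    using U C(2) r open_connected_component connected_component_subset[of U "of_real r"]
      connected_component_refl[of "of_real r" U] by auto
  have zS: "z \<in> ?S" using C r connected_component_maximal by blast
  define \<phi> where "\<phi> v q = Complex (inner q v) (- inner (I * q) v)" for v q :: quat
  have \<phi>_eq: "\<phi> v = (\<lambda>q. of_real (inner q v) - \<i> * of_real (inner (I * q) v))" for v
    by (simp add: \<phi>_def fun_eq_iff complex_eq_iff)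
  have \<phi>_bl: "bounded_linear (\<phi> v)" for v
    unfolding \<phi>_eq
    by (intro bounded_linear_sub bounded_linear_const_mult 
        bounded_linear_compose[OF bounded_linear_of_real]
        bounded_linear_compose[OF bounded_linear_inner_left] bounded_linear_mult_right
        bounded_linear_ident bounded_linear_inner_left)
  have \<phi>_I: "\<phi> v (I * q) = \<i> * \<phi> v q" for v q
    using imag_units_sq[OF I] by (simp add: \<phi>_def complex_eq_iff flip: mult.assoc)
  have hol: "(\<lambda>z. \<phi> v (h z)) holomorphic_on ?S" for v
  proof (rule holomorphic_onI)
    fix w assume "w \<in> ?S"
    then obtain D where D: "(h has_derivative D) (at w)" "D \<i> = I * D 1"
      using h S(3) by blast
    have lin: "linear D" using D(1) by (rule has_derivative_linear)
    have "\<phi> v (D x) = \<phi> v (D 1) * x" for x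
    proof -
      have "D x = D (Re x *\<^sub>R 1 + Im x *\<^sub>R \<i>)"
        by (rule arg_cong[of _ _ D]) (simp add: complex_eq_iff)
      also have "\<dots> = Re x *\<^sub>R D 1 + Im x *\<^sub>R (I * D 1)"
        by (simp only: linear_add[OF lin] linear_cmul[OF lin] D(2))
      finally have "\<phi> v (D x) = Re x *\<^sub>R \<phi> v (D 1) + Im x *\<^sub>R (\<i> * \<phi> v (D 1))"
        by (simp only: linear_add[OF bounded_linear.linear[OF \<phi>_bl]]
            linear_cmul[OF bounded_linear.linear[OF \<phi>_bl]] \<phi>_I)
      also have "\<dots> = \<phi> v (D 1) * x" by (simp add: complex_eq_iff algebra_simps)
      finally show ?thesis .
    qed
    then have "(\<lambda>x. \<phi> v (D x)) = (*) (\<phi> v (D 1))" by (rule ext)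
    then have "((\<lambda>z. \<phi> v (h z)) has_derivative (*) (\<phi> v (D 1))) (at w)"
      using bounded_linear.has_derivative[OF \<phi>_bl D(1)] by metis
    then show "(\<lambda>z. \<phi> v (h z)) field_differentiable at w within ?S"
      by (metis field_differentiable_def has_field_derivative_def
          has_field_derivative_at_within)
  qed
  \<comment> \<open>The component contains a disc around \<open>r\<close>, so the real zeros
    accumulate inside it.\<close>
  have lim: "of_real r islimpt (?S \<inter> \<real>)"
    unfolding islimpt_approachable
  proof (intro allI impI)
    fix e :: real assume "e > 0"
    obtain d where d: "d > 0" "ball (of_real r) d \<subseteq> ?S"
      using S openE by blast
    define y :: complex where "y = of_real (r + min d e / 2)"
    have "dist y (of_real r) = min d e / 2"
      using d(1) \<open>e > 0\<close> by (simp add: y_def dist_norm flip: of_real_diff)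
    moreover have "0 < min d e / 2" "min d e / 2 < d" "min d e / 2 < e"
      using d(1) \<open>e > 0\<close> by auto
    ultimately show "\<exists>x'\<in>?S \<inter> \<real>. x' \<noteq> of_real r \<and> dist x' (of_real r) < e"
      using d(2) by (intro bexI[of _ y]) (auto simp: y_def dist_commute subset_iff)
  qed
  have "\<phi> v (h z) = 0" for v
  proof (rule analytic_continuation[OF hol S(1,2) _ S(4) lim _ zS])
    show "\<phi> v (h w) = 0" if "w \<in> ?S \<inter> \<real>" for w
    proof -
      have "h w = 0" using that S(3) h0 by (auto simp: Reals_def)
      then show ?thesis by (simp add: \<phi>_def complex_eq_iff)
    qed
  qed auto
  \<comment> \<open>For \<open>v = h z\<close> the real part is the squared norm of
    \<open>h z\<close>.\<close>
  from this[of "h z"] show ?thesis by (simp add: \<phi>_def complex_eq_iff)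
qed

lemma representation_formula:
  assumes \<Omega>: "open \<Omega>" and f: "slice_regular_on \<Omega> f"
    and IJK: "I \<in> \<S>" "J \<in> \<S>" "K \<in> \<S>" "J \<noteq> K"
    and C: "spear z C" "\<And>L w. L \<in> {I, J, K} \<Longrightarrow> w \<in> C \<Longrightarrow> slice_emb L w \<in> \<Omega>"
  shows "f (slice_emb I z) =
    inverse (J - K) * (J * f (slice_emb J z) - K * f (slice_emb K z))
    + I * inverse (J - K) * (f (slice_emb J z) - f (slice_emb K z))"
proof -
  define m where "m = inverse (J - K)"
  define h where "h w = f (slice_emb I w) -
    (m * (J * f (slice_emb J w) - K * f (slice_emb K w))
    + I * m * (f (slice_emb J w) - f (slice_emb K w)))" for w
  let ?U = "slice_emb I -` \<Omega> \<inter> slice_emb J -` \<Omega> \<inter> slice_emb K -` \<Omega>"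
  have "h z = 0"
  proof (rule slice_identity_principle[where U = ?U and C = C])
    show "open ?U"
      by (intro open_Int open_vimage \<Omega> continuous_intros)
  next
    fix w assume w: "w \<in> ?U"
    obtain A where A: "((\<lambda>w. f (slice_emb I w)) has_derivative A) (at w)" "A \<i> = I * A 1"
      using slice_regular_has_derivative[OF f IJK(1)] w by blast
    obtain B where B: "((\<lambda>w. f (slice_emb J w)) has_derivative B) (at w)" "B \<i> = J * B 1"
      using slice_regular_has_derivative[OF f IJK(2)] w by blast
    obtain E where E: "((\<lambda>w. f (slice_emb K w)) has_derivative E) (at w)" "E \<i> = K * E 1"
      using slice_regular_has_derivative[OF f IJK(3)] w by blast
    let ?D = "\<lambda>v. A v - (m * (J * B v - K * E v) + I * m * (B v - E v))"
    have "(h has_derivative ?D) (at w)"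
      unfolding h_def
      by (intro has_derivative_diff has_derivative_add has_derivative_mult_right A B E)
    moreover have "?D \<i> = I * ?D 1"
    proof -
      have sq: "L * (L * q) = - q" if "L \<in> {I, J, K}" for L q
        using that IJK by (auto simp: imag_units_sq simp flip: mult.assoc)
      \<comment> \<open>Since \<open>J\<close> and \<open>K\<close> square to -1, passing from 1 to
        \<open>\<i>\<close> interchanges, up to sign, the two differences in the formula. The factor
        \<open>I\<close> of the second term compensates for this after \<open>- q\<close> is
        rewritten as \<open>I * (I * q)\<close>.\<close>
      have "?D \<i> = I * A 1 - (m * (E 1 - B 1) + I * m * (J * B 1 - K * E 1))"
        using sq by (simp add: A(2) B(2) E(2))
      also have "\<dots> = I * A 1 - (I * (m * (J * B 1 - K * E 1)) - m * (B 1 - E 1))"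
        by (simp add: algebra_simps)
      also have "\<dots> = I * A 1 - (I * (m * (J * B 1 - K * E 1)) + I * (I * (m * (B 1 - E 1))))"
        using sq by simp
      also have "\<dots> = I * ?D 1"
        by (simp add: distrib_left right_diff_distrib mult.assoc)
      finally show ?thesis .
    qed
    ultimately show "\<exists>D. (h has_derivative D) (at w) \<and> D \<i> = I * D 1" by blast
  next
    fix r
    \<comment> \<open>At a real point the three embeddings agree, so the term with factor
      \<open>I\<close> vanishes and only this one remains.\<close>
    have "m * (J * f (of_real r) - K * f (of_real r)) = m * (J - K) * f (of_real r)"
      by (simp add: left_diff_distrib mult.assoc)
    also have "m * (J - K) = 1"
      using IJK(4) by (simp add: m_def)
    finally show "h (of_real r) = 0" by (simp add: h_def)
  qed (use C IJK in \<open>auto simp: spear_def\<close>)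
  then show ?thesis by (simp add: h_def m_def)
qed

subsection \<open>The conical neighbourhood of a half slice\<close>

text \<open>The quantifier order matters: a single \<open>C\<close> must serve all units of the
  ball.\<close>

definition spear_cone :: "quat set \<Rightarrow> quat \<Rightarrow> real \<Rightarrow> complex \<Rightarrow> bool" where
  "spear_cone \<Omega> J \<epsilon> z \<longleftrightarrow> (\<exists>C. spear z C \<and>
     (\<forall>w\<in>C. \<forall>I\<in>\<S>. dist I J < \<epsilon> \<longrightarrow> slice_emb I w \<in> \<Omega>))"

text \<open>Only nonreal points are collected, so that unit and coordinate can be recovered from the
  point; the real points come from the core.\<close>

definition spear_nbhd :: "quat set \<Rightarrow> quat \<Rightarrow> quat set" where
  "spear_nbhd \<Omega> J = {slice_emb I z | I z. I \<in> \<S> \<and> 0 < Im z \<and> (\<exists>\<epsilon>. dist I J < \<epsilon> \<and> spear_cone \<Omega> J \<epsilon> z)}"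

lemma spear_coneE:
  assumes "spear_cone \<Omega> J \<epsilon> z"
  obtains C where "spear z C" "\<And>w I. w \<in> C \<Longrightarrow> I \<in> \<S> \<Longrightarrow> dist I J < \<epsilon> \<Longrightarrow> slice_emb I w \<in> \<Omega>"
  using assms unfolding spear_cone_def by blast

lemma spear_nbhd_subset: "spear_nbhd \<Omega> J \<subseteq> \<Omega>"
  unfolding spear_nbhd_def spear_cone_def spear_def by blast

lemma slice_emb_spear_nbhdE:
  assumes "slice_emb I z \<in> spear_nbhd \<Omega> J" "I \<in> \<S>" "0 \<le> Im z"
  obtains \<epsilon> where "dist I J < \<epsilon>" "spear_cone \<Omega> J \<epsilon> z" "0 < Im z"
  using assms slice_emb_eqD[of _ _ I z] unfolding spear_nbhd_def by (smt (verit) mem_Collect_eq)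

text \<open>Shrinking the radius to \<delta> makes the relevant units part of a compact set, so the
  copies of \<open>z\<close> have balls of a common radius inside \<Omega>. The corresponding disc
  around \<open>z\<close> is then attached to \<open>C\<close>.\<close>

lemma spear_cone_eventually:
  assumes \<Omega>: "open \<Omega>" and z: "spear_cone \<Omega> J \<epsilon> z" "0 < Im z" and \<delta>: "\<delta> < \<epsilon>"
  obtains \<rho> where "\<rho> > 0" "\<And>w. w \<in> ball z \<rho> \<Longrightarrow> spear_cone \<Omega> J \<delta> w \<and> 0 < Im w"
proof -
  obtain C where C: "spear z C"
    "\<And>w I. w \<in> C \<Longrightarrow> I \<in> \<S> \<Longrightarrow> dist I J < \<epsilon> \<Longrightarrow> slice_emb I w \<in> \<Omega>"
    using z spear_coneE by blast
  let ?P = "(\<lambda>I. slice_emb I z) ` (\<S> \<inter> cball J \<delta>)"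
  have "compact ?P"
    unfolding slice_emb_def
    by (intro compact_continuous_image compact_Int_closed compact_imag_units continuous_intros) auto
  moreover have "?P \<subseteq> \<Omega>"
    using C \<delta> by (auto simp: spear_def dist_commute)
  ultimately obtain e where e: "e > 0" "(\<Union>x\<in>?P. ball x e) \<subseteq> \<Omega>"
    using \<Omega> by (metis compact_subset_open_imp_ball_epsilon_subset)
  \<comment> \<open>The bound \<open>Im z\<close> keeps the disc in the upper half plane.\<close>
  define \<rho> where "\<rho> = min e (Im z)"
  have Im: "0 < Im w" if "w \<in> ball z \<rho>" for w
    using that abs_Im_le_cmod[of "z - w"] by (auto simp: \<rho>_def dist_norm)
  have \<rho>\<Omega>: "slice_emb I w \<in> \<Omega>" if "w \<in> ball z \<rho>" "I \<in> \<S>" "dist I J < \<delta>" for I w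
  proof -
    have "slice_emb I w \<in> ball (slice_emb I z) e"
      using that by (simp add: dist_slice_emb \<rho>_def)
    then show ?thesis using e(2) that by (force simp: dist_commute)
  qed
  have "spear_cone \<Omega> J \<delta> w" if w: "w \<in> ball z \<rho>" for w
    unfolding spear_cone_def
  proof (intro exI conjI ballI impI)
    have "z \<in> ball z \<rho>" using w by (auto simp: \<rho>_def e(1) z(2))
    then show "spear w (C \<union> ball z \<rho>)"
      using C(1) w Im by (auto simp: spear_def less_imp_le intro!: connected_Un)
    show "slice_emb I x \<in> \<Omega>" if "x \<in> C \<union> ball z \<rho>" "I \<in> \<S>" "dist I J < \<delta>" for x I
      using that \<rho>\<Omega> C(2) \<delta> by auto
  qed
  moreover have "\<rho> > 0" using e z by (simp add: \<rho>_def)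
  ultimately show ?thesis using Im that by blast
qed

lemma open_spear_nbhd:
  assumes "open \<Omega>"
  shows "open (spear_nbhd \<Omega> J)"
proof (subst open_subopen, intro ballI)
  fix x assume "x \<in> spear_nbhd \<Omega> J"
  then obtain I z \<epsilon> where x: "x = slice_emb I z" "I \<in> \<S>" "0 < Im z" "dist I J < \<epsilon>" "spear_cone \<Omega> J \<epsilon> z"
    by (auto simp: spear_nbhd_def)
  \<comment> \<open>The gap on either side of \<delta> leaves room to vary the unit and the
    coordinate simultaneously.\<close>
  obtain \<delta> where \<delta>: "dist I J < \<delta>" "\<delta> < \<epsilon>" using x(4) dense by blast
  obtain \<rho> where \<rho>: "\<rho> > 0" "\<And>w. w \<in> ball z \<rho> \<Longrightarrow> spear_cone \<Omega> J \<delta> w \<and> 0 < Im w"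
    using spear_cone_eventually[OF assms x(5,3) \<delta>(2)] by blast
  \<comment> \<open>Polar coordinates: \<open>q\<close> has unit \<open>dir q\<close> and coordinate
    \<open>zz q\<close>, both continuous off the real axis.\<close>
  define im where "im q = q - of_real (qre q)" for q :: quat
  define zz where "zz q = of_real (qre q) + \<i> * of_real (norm (im q))" for q :: quat
  define dir where "dir q = im q /\<^sub>R norm (im q)" for q :: quat
  have im_cont [continuous_intros]: "continuous_on S im" for S
    unfolding im_def by (intro continuous_intros)
  have emb: "slice_emb (dir q) (zz q) = q" "dir q \<in> \<S>" if "im q \<noteq> 0" for q
  proof -
    show "slice_emb (dir q) (zz q) = q"
      using that by (simp add: slice_emb_def zz_def dir_def scaleR_conv_of_real flip: mult.assoc)
        (simp add: im_def flip: of_real_mult)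
    show "dir q \<in> \<S>"
      using that by (intro imag_unitI) (simp_all add: dir_def im_def)
  qed
  have imx: "im x = Im z *\<^sub>R I"
    using x by (simp add: im_def qre_slice_emb) (simp add: slice_emb_def scaleR_conv_of_real)
  have nim: "norm (im x) = Im z" using imx x by (simp add: norm_imag_unit)
  have zx: "zz x = z" 
    using x nim by (simp add: zz_def qre_slice_emb complex_eq_iff)
  have dirx: "dir x = I" using x(3) by (simp add: dir_def nim) (simp add: imx)
  let ?T = "{q \<in> -{q. im q = 0}. dir q \<in> ball J \<delta> \<and> zz q \<in> ball z \<rho>}"
  have opn: "open (-{q. im q = 0})"
    by (intro open_Compl closed_Collect_eq continuous_intros)
  have "?T = (-{q. im q = 0} \<inter> dir -` ball J \<delta>) \<inter> (-{q. im q = 0} \<inter> zz -` ball z \<rho>)"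
    by auto
  moreover have "open (-{q. im q = 0} \<inter> dir -` ball J \<delta>)"
    by (rule continuous_open_preimage[OF _ opn open_ball])
      (auto simp: dir_def intro!: continuous_intros)
  moreover have "open (-{q. im q = 0} \<inter> zz -` ball z \<rho>)"
    by (rule continuous_open_preimage[OF _ opn open_ball])
      (auto simp: zz_def intro!: continuous_intros)
  ultimately have "open ?T" by auto
  moreover have "x \<in> ?T"
    using x(3) nim \<rho>(1) \<delta>(1) zx dirx by (auto simp: dist_commute)
  moreover have "?T \<subseteq> spear_nbhd \<Omega> J"
  proof
    fix q assume q: "q \<in> ?T"
    then have "spear_cone \<Omega> J \<delta> (zz q) \<and> 0 < Im (zz q)" using \<rho>(2) by blast
    moreover have "dist (dir q) J < \<delta>" using q by (simp add: dist_commute)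
    ultimately show "q \<in> spear_nbhd \<Omega> J"
      using emb[of q] q unfolding spear_nbhd_def
      by (intro CollectI exI[of _ "dir q"] exI[of _ "zz q"]) auto
  qed
  ultimately show "\<exists>T. open T \<and> x \<in> T \<and> T \<subseteq> spear_nbhd \<Omega> J" by blast
qed

section \<open>The set \<Lambda> and the formula on it\<close>

text \<open>A set \<open>C\<close> witnessing the cone condition at \<open>z\<close> also witnesses
  it at each of its nonreal points, and its real points lie in the core. Hence its copy stays in the
  union.\<close>

lemma speared_open_core_Un_spear_nbhd:
  assumes "open \<Omega>"
  shows "speared_open (core \<Omega> \<union> spear_nbhd \<Omega> J)"
proof (rule speared_openI)
  show "open (core \<Omega> \<union> spear_nbhd \<Omega> J)"
    using speared_open_core open_spear_nbhd[OF assms] by (auto simp: speared_open_def)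
  fix I z assume I: "I \<in> \<S>" and z: "0 \<le> Im z" and "slice_emb I z \<in> core \<Omega> \<union> spear_nbhd \<Omega> J"
  then consider "slice_emb I z \<in> core \<Omega>" | "slice_emb I z \<in> spear_nbhd \<Omega> J" by blast
  then show "\<exists>C. spear z C \<and> slice_emb I ` C \<subseteq> core \<Omega> \<union> spear_nbhd \<Omega> J"
  proof cases
    case 1
    obtain C where "spear z C" "compact C" "slice_emb I ` C \<subseteq> core \<Omega>"
      by (rule speared_openE[OF speared_open_core I z 1])
    then show ?thesis by blast
  next
    case 2
    then obtain \<epsilon> where \<epsilon>: "dist I J < \<epsilon>" "spear_cone \<Omega> J \<epsilon> z"
      using slice_emb_spear_nbhdE I z by blast
    then obtain C where C: "spear z C"
      "\<And>w I. w \<in> C \<Longrightarrow> I \<in> \<S> \<Longrightarrow> dist I J < \<epsilon> \<Longrightarrow> slice_emb I w \<in> \<Omega>"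
      using spear_coneE by blast
    have "slice_emb I w \<in> core \<Omega> \<union> spear_nbhd \<Omega> J" if w: "w \<in> C" for w
    proof (cases "Im w = 0")
      case True
      then show ?thesis
        using C(2)[OF w I \<epsilon>(1)] of_real_in_core[OF assms] by (simp add: slice_emb_real)
    next
      case False
      then have "0 < Im w" using C(1) w by (force simp: spear_def)
      moreover have "spear_cone \<Omega> J \<epsilon> w"
        using C w unfolding spear_cone_def spear_def by blast
      ultimately show ?thesis
        using I \<epsilon>(1) by (auto simp: spear_nbhd_def)
    qed
    then show ?thesis using C(1) by blast
  qed
qed

text \<open>Replacing \<open>J\<close> by \<open>I\<close> moves a point of the compact spear by at
  most its norm bound \<open>b\<close> times \<open>dist I J\<close>. Thus the radius
  \<open>e / b\<close> keeps all copies within distance \<open>e\<close> of the original, inside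
  \<Omega>.\<close>

lemma half_slice_subset_core_Un_spear_nbhd:
  assumes \<Omega>: "speared_open \<Omega>" and J: "J \<in> \<S>"
  shows "\<Omega> \<inter> half_slice J \<subseteq> core \<Omega> \<union> spear_nbhd \<Omega> J"
proof
  fix x assume "x \<in> \<Omega> \<inter> half_slice J"
  then obtain z where z: "x = slice_emb J z" "slice_emb J z \<in> \<Omega>" "0 \<le> Im z"
    by (auto simp: half_slice_eq)
  have op: "open \<Omega>" using \<Omega> by (simp add: speared_open_def)
  show "x \<in> core \<Omega> \<union> spear_nbhd \<Omega> J"
  proof (cases "Im z = 0")
    case True
    then show ?thesis using z of_real_in_core[OF op] by (simp add: slice_emb_real)
  next
    case False
    obtain C where C: "spear z C" "compact C" "slice_emb J ` C \<subseteq> \<Omega>"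
      using speared_openE[OF \<Omega> J z(3,2)] by blast
    have "compact (slice_emb J ` C)"
      by (intro compact_continuous_image C continuous_intros)
    then obtain e where e: "e > 0" "(\<Union>x\<in>slice_emb J ` C. ball x e) \<subseteq> \<Omega>"
      using C op by (metis compact_subset_open_imp_ball_epsilon_subset)
    obtain b where b: "b > 0" "\<And>w. w \<in> C \<Longrightarrow> norm w \<le> b"
      using compact_imp_bounded[OF C(2)] by (auto simp: bounded_pos)
    have "spear_cone \<Omega> J (e / b) z"
      unfolding spear_cone_def
    proof (intro exI conjI ballI impI)
      fix w I assume w: "w \<in> C" and I: "dist I J < e / b"
      have "slice_emb J w - slice_emb I w = Im w *\<^sub>R (J - I)"
        by (simp add: slice_emb_def scaleR_conv_of_real algebra_simps)
      then have "dist (slice_emb J w) (slice_emb I w) = \<bar>Im w\<bar> * dist I J"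
        by (simp add: dist_norm norm_minus_commute)
      also have "\<dots> \<le> b * dist I J"
        using b(2)[OF w] abs_Im_le_cmod[of w] by (intro mult_right_mono) auto
      also have "\<dots> < e" using I b(1) by (simp add: field_simps)
      finally have "slice_emb I w \<in> ball (slice_emb J w) e" by simp
      then show "slice_emb I w \<in> \<Omega>" using e(2) w by blast
    qed (rule C)
    then show ?thesis
      using z False J e(1) b(1) by (auto simp: spear_nbhd_def intro!: exI[of _ J] exI[of _ z] exI[of _ "e / b"])
  qed
qed

lemma representation_formula_on_core_Un_spear_nbhd:
  assumes \<Omega>: "open \<Omega>" and f: "slice_regular_on \<Omega> f"
    and IJK: "I \<in> \<S>" "J \<in> \<S>" "K \<in> \<S>" "J \<noteq> K" and z: "0 \<le> Im z"
    and mem: "\<And>L. L \<in> {I, J, K} \<Longrightarrow> slice_emb L z \<in> core \<Omega> \<union> spear_nbhd \<Omega> J\<^sub>0"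
  shows "f (slice_emb I z) =
    inverse (J - K) * (J * f (slice_emb J z) - K * f (slice_emb K z))
    + I * inverse (J - K) * (f (slice_emb J z) - f (slice_emb K z))"
\<comment> \<open>By symmetry of the core, one point in it suffices to carry a spear to all three
  units.\<close>
proof (cases "\<exists>L\<in>{I, J, K}. slice_emb L z \<in> core \<Omega>")
  case True
  then obtain L where L: "L \<in> \<S>" "slice_emb L z \<in> core \<Omega>" using IJK by blast
  obtain C where C: "spear z C" "compact C" "slice_emb L ` C \<subseteq> core \<Omega>"
    by (rule speared_openE[OF speared_open_core L(1) z L(2)])
  have "slice_emb M w \<in> \<Omega>" if "M \<in> {I, J, K}" "w \<in> C" for M w
  proof -
    have "M \<in> \<S>" using that IJK by blast
    moreover have "slice_emb L w \<in> core \<Omega>" using C(3) that by blast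
    ultimately have "slice_emb M w \<in> core \<Omega>"
      using symmetric_core[of \<Omega>] L(1) unfolding symmetric_set_def slice_emb_def by blast
    then show ?thesis using core_subset by blast
  qed
  then show ?thesis by (rule representation_formula[OF \<Omega> f IJK C(1)])
next
  case False
  have "\<exists>\<epsilon>. dist L J\<^sub>0 < \<epsilon> \<and> spear_cone \<Omega> J\<^sub>0 \<epsilon> z" if "L \<in> {I, J, K}" for L
    using slice_emb_spear_nbhdE[of L z \<Omega> J\<^sub>0] mem[OF that] that IJK z False by blast
  then obtain E where E: "\<And>L. L \<in> {I, J, K} \<Longrightarrow> dist L J\<^sub>0 < E L \<and> spear_cone \<Omega> J\<^sub>0 (E L) z"
    by metis
  \<comment> \<open>The unit with the largest radius supplies the common spear, because its ball
    contains the other two units.\<close>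
  have "Max (E ` {I, J, K}) \<in> E ` {I, J, K}"
    by (rule Max_in) simp_all
  then obtain L where L: "L \<in> {I, J, K}" "Max (E ` {I, J, K}) = E L" by (rule imageE)
  obtain C where C: "spear z C"
    "\<And>w I. w \<in> C \<Longrightarrow> I \<in> \<S> \<Longrightarrow> dist I J\<^sub>0 < E L \<Longrightarrow> slice_emb I w \<in> \<Omega>"
    using E[OF L(1)] spear_coneE by blast
  have "slice_emb M w \<in> \<Omega>" if M: "M \<in> {I, J, K}" and "w \<in> C" for M w
  proof -
    have "E M \<le> E L" unfolding L(2)[symmetric] by (rule Max_ge) (use M in auto)
    then have "dist M J\<^sub>0 < E L" using E[OF M] by linarith
    then show ?thesis using C(2) that IJK by blast
  qed
  then show ?thesis by (rule representation_formula[OF \<Omega> f IJK C(1)])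
qed

theorem corollary4p14:
  fixes \<Omega> :: "quat set" and f :: "quat \<Rightarrow> quat" and J\<^sub>0 :: quat
  assumes "speared_domain \<Omega>"
    and "slice_regular_on \<Omega> f"
    and "J\<^sub>0 \<in> \<S>"
  shows "\<exists>\<Lambda>. speared_open \<Lambda> \<and> \<Lambda> \<subseteq> \<Omega> \<and> core \<Omega> \<subseteq> \<Lambda> \<and> \<Omega> \<inter> half_slice J\<^sub>0 \<subseteq> \<Lambda> \<and>
    (\<forall>I\<in>\<S>. \<forall>J\<in>\<S>. \<forall>K\<in>\<S>. \<forall>\<alpha> \<beta> :: real.
       J \<noteq> K \<longrightarrow> \<beta> \<ge> 0 \<longrightarrow>
       slice_pt \<alpha> \<beta> I \<in> \<Lambda> \<longrightarrow> slice_pt \<alpha> \<beta> J \<in> \<Lambda> \<longrightarrow> slice_pt \<alpha> \<beta> K \<in> \<Lambda> \<longrightarrow>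
       f (slice_pt \<alpha> \<beta> I) =
         inverse (J - K) * (J * f (slice_pt \<alpha> \<beta> J) - K * f (slice_pt \<alpha> \<beta> K))
         + I * inverse (J - K) * (f (slice_pt \<alpha> \<beta> J) - f (slice_pt \<alpha> \<beta> K)))"
proof (intro exI[of _ "core \<Omega> \<union> spear_nbhd \<Omega> J\<^sub>0"] conjI ballI allI impI)
  have \<Omega>: "speared_open \<Omega>" "open \<Omega>"
    using assms(1) by (auto simp: speared_domain_def speared_open_def)
  show "speared_open (core \<Omega> \<union> spear_nbhd \<Omega> J\<^sub>0)"
    by (rule speared_open_core_Un_spear_nbhd[OF \<Omega>(2)])
  show "core \<Omega> \<union> spear_nbhd \<Omega> J\<^sub>0 \<subseteq> \<Omega>"
    using core_subset spear_nbhd_subset by blast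
  show "\<Omega> \<inter> half_slice J\<^sub>0 \<subseteq> core \<Omega> \<union> spear_nbhd \<Omega> J\<^sub>0"
    by (rule half_slice_subset_core_Un_spear_nbhd[OF \<Omega>(1) assms(3)])
  fix I J K :: quat and \<alpha> \<beta> :: real
  assume IJK: "I \<in> \<S>" "J \<in> \<S>" "K \<in> \<S>" "J \<noteq> K" and "0 \<le> \<beta>"
    and mem: "slice_pt \<alpha> \<beta> I \<in> core \<Omega> \<union> spear_nbhd \<Omega> J\<^sub>0"
      "slice_pt \<alpha> \<beta> J \<in> core \<Omega> \<union> spear_nbhd \<Omega> J\<^sub>0"
      "slice_pt \<alpha> \<beta> K \<in> core \<Omega> \<union> spear_nbhd \<Omega> J\<^sub>0"
  have emb: "slice_emb L (Complex \<alpha> \<beta>) = slice_pt \<alpha> \<beta> L" for L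
    by (simp add: slice_emb_def)
  show "f (slice_pt \<alpha> \<beta> I) =
         inverse (J - K) * (J * f (slice_pt \<alpha> \<beta> J) - K * f (slice_pt \<alpha> \<beta> K))
         + I * inverse (J - K) * (f (slice_pt \<alpha> \<beta> J) - f (slice_pt \<alpha> \<beta> K))"
    using representation_formula_on_core_Un_spear_nbhd[OF \<Omega>(2) assms(2) IJK,
        of "Complex \<alpha> \<beta>" J\<^sub>0, unfolded emb] \<open>0 \<le> \<beta>\<close> mem by auto
qed auto

end
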